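(* There exists an absolute constant $c>0$ such that the following holds. Let $r$ be a positive integer and let $M\in\{0,1\}^{m\times n}$ with $\operatorname{rank}(M)\leq r$. Let $p=\frac{|M|}{mn}$ and suppose $p\leq 1/2$. Then $$\operatorname{disc}(M)\geq c\,mn\cdot\min\left\{p,\frac{p^{1/2}}{\sqrt{r}}\right\}.$$
   Context: For a binary matrix $M\in\{0,1\}^{m\times n}$, $|M|$ denotes the number of $1$ entries of $M$, and for $X\subset[m]$, $Y\subset[n]$, $M[X\times Y]$ is the submatrix with rows $X$ and columns $Y$. With $p=|M|/(mn)$, the discrepancy is $\operatorname{disc}(M)=\max_{X\subset[m],Y\subset[n]}\big||M[X\times Y]|-p|X||Y|\big|$. *)

theory Defs
  imports "Jordan_Normal_Form.DL_Rank"
begin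

definition sub_ones :: "real mat \<Rightarrow> nat set \<Rightarrow> nat set \<Rightarrow> nat" where
  "sub_ones M X Y = card {(i, j). i \<in> X \<and> j \<in> Y \<and> M $$ (i, j) = 1}"

definition ones :: "real mat \<Rightarrow> nat" where
  "ones M = sub_ones M {..<dim_row M} {..<dim_col M}"

definition density :: "real mat \<Rightarrow> real" where
  "density M = real (ones M) / (real (dim_row M) * real (dim_col M))"

definition disc :: "real mat \<Rightarrow> real" where
  "disc M = Max ((\<lambda>(X, Y). \<bar>real (sub_ones M X Y) - density M * real (card X) * real (card Y)\<bar>)
                 ` (Pow {..<dim_row M} \<times> Pow {..<dim_col M}))"

end

theory Submission
  imports Defs
begin

text \<open>
  Orthonormalising the column space of M gives M(a, b) = <x a, y b> in dimension k \<le> r, where the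
  squared norms of the x a sum to k and the squared norm of y b is the number of ones in column b;
  one more coordinate turns this into a factorisation of B = M - pJ.
  Few rows have norm far above average, and few columns have far more than pm ones; deleting them
  loses only a small part of the ones unless the discrepancy is already of order pmn.
  On what remains, all |x a| |y b| are O(sqrt (pr)) while the sum of B(a, b) <x a, y b> is the sum
  of the squares B(a, b)^2, which is of order pmn. Grothendieck's inequality replaces the vectors by
  signs at the cost of a constant factor, and a sign sum is at most 4 disc(M).
\<close>

section \<open>Coordinate inner products and the rank factorization\<close>

definition ip :: "nat \<Rightarrow> (nat \<Rightarrow> real) \<Rightarrow> (nat \<Rightarrow> real) \<Rightarrow> real" where
  "ip N x y = (\<Sum>i<N. x i * y i)"

lemma ip_commute: "ip N x y = ip N y x"
  by (simp add: ip_def mult.commute)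

lemma ip_self_nonneg: "0 \<le> ip N x x"
  by (simp add: ip_def sum_nonneg)

lemma ip_scale_left: "ip N (\<lambda>i. c * x i) y = c * ip N x y"
  by (simp add: ip_def sum_distrib_left mult.assoc)

lemma ip_scale_right: "ip N x (\<lambda>i. c * y i) = c * ip N x y"
  by (simp add: ip_def sum_distrib_left mult.left_commute)

lemma ip_add_right: "ip N x (\<lambda>i. y i + z i) = ip N x y + ip N x z"
  by (simp add: ip_def sum.distrib distrib_left)

lemma ip_diff_right: "ip N x (\<lambda>i. y i - z i) = ip N x y - ip N x z"
  by (simp add: ip_def sum_subtractf right_diff_distrib)

lemma ip_sum_right: "ip N x (\<lambda>i. \<Sum>j\<in>A. f j i) = (\<Sum>j\<in>A. ip N x (f j))"
  unfolding ip_def sum_distrib_left by (rule sum.swap)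

lemma ip_cong: "(\<And>i. i < N \<Longrightarrow> x i = x' i) \<Longrightarrow> (\<And>i. i < N \<Longrightarrow> y i = y' i) \<Longrightarrow> ip N x y = ip N x' y'"
  by (simp add: ip_def)

lemma ip_self_eq_0D: "ip N x x = 0 \<Longrightarrow> i < N \<Longrightarrow> x i = 0"
  by (auto simp: ip_def sum_nonneg_eq_0_iff)

text \<open>Gram-Schmidt, one vector at a time. A vector whose residue \<open>w\<close> vanishes
  below \<open>m\<close> adds nothing to the system, so \<open>k\<close> may stay below
  \<open>card V\<close>.\<close>

lemma orthonormal_system_exists:
  assumes "finite V"
  shows "\<exists>k e. k \<le> card V \<and> (\<forall>i<k. \<forall>j<k. ip m (e i) (e j) = (if i = j then 1 else 0)) \<and>
    (\<forall>v\<in>V. \<forall>a<m. v a = (\<Sum>i<k. ip m (e i) v * e i a))"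
  using assms
proof (induction V rule: finite_induct)
  case empty
  show ?case by (intro exI[of _ 0]) simp
next
  case (insert v V)
  then obtain k e where k: "k \<le> card V"
    and orth: "\<And>i j. i < k \<Longrightarrow> j < k \<Longrightarrow> ip m (e i) (e j) = (if i = j then 1 else 0)"
    and rep: "\<And>u a. u \<in> V \<Longrightarrow> a < m \<Longrightarrow> u a = (\<Sum>i<k. ip m (e i) u * e i a)"
    by blast
  define w where "w a = v a - (\<Sum>i<k. ip m (e i) v * e i a)" for a
  have ew: "ip m (e j) w = 0" if "j < k" for j
  proof -
    have "ip m (e j) w = ip m (e j) v - (\<Sum>i<k. ip m (e i) v * ip m (e j) (e i))"
      unfolding w_def by (simp add: ip_diff_right ip_sum_right ip_scale_right)
    also have "(\<Sum>i<k. ip m (e i) v * ip m (e j) (e i)) = (\<Sum>i<k. if j = i then ip m (e i) v else 0)"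
      using that by (intro sum.cong) (auto simp: orth)
    finally show ?thesis using that by simp
  qed
  show ?case
  proof (cases "ip m w w = 0")
    case True
    then have "v a = (\<Sum>i<k. ip m (e i) v * e i a)" if "a < m" for a
      using ip_self_eq_0D[OF True that] by (simp add: w_def)
    then show ?thesis
      using k orth rep insert.hyps by (intro exI[of _ k] exI[of _ e]) auto
  next
    case False
    define s where "s = sqrt (ip m w w)"
    have s: "s > 0" "s * s = ip m w w"
      using False ip_self_nonneg[of m w] by (auto simp: s_def)
    define e' where "e' = e(k := (\<lambda>a. (1/s) * w a))"
    have e'k: "e' k = (\<lambda>a. (1/s) * w a)" and e'i: "\<And>i. i < k \<Longrightarrow> e' i = e i"
      by (auto simp: e'_def)
    have we: "ip m w (e j) = 0" if "j < k" for j
      using ew[OF that] by (simp add: ip_commute)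
    have orth': "ip m (e' i) (e' j) = (if i = j then 1 else 0)" if "i < Suc k" "j < Suc k" for i j
    proof -
      have "1 / s * (1 / s * ip m w w) = 1" using s by (simp flip: s(2))
      then show ?thesis
        using that unfolding less_Suc_eq
        by (auto simp: e'k e'i orth ew we ip_scale_left ip_scale_right simp del: times_divide_eq_left)
    qed
    \<comment> \<open>The residue is orthogonal to the part of \<open>v\<close> that was subtracted,
      so \<open>v\<close> has coefficient exactly \<open>s\<close> along the normalised
      residue.\<close>
    have wv: "ip m w v = s * s"
    proof -
      have "v = (\<lambda>a. w a + (\<Sum>i<k. ip m (e i) v * e i a))"
        by (simp add: w_def)
      then have "ip m w v = ip m w (\<lambda>a. w a + (\<Sum>i<k. ip m (e i) v * e i a))" by simp
      also have "\<dots> = ip m w w + (\<Sum>i<k. ip m (e i) v * ip m w (e i))"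
        by (simp add: ip_add_right ip_sum_right ip_scale_right)
      finally show ?thesis by (simp add: we s)
    qed
    have e'k_ip: "ip m (e' k) u = 1 / s * ip m w u" for u
      unfolding e'k by (rule ip_scale_left)
    have rep': "u a = (\<Sum>i<Suc k. ip m (e' i) u * e' i a)" if "u \<in> insert v V" "a < m" for u a
    proof (cases "u = v")
      case True
      have "ip m (e' k) v * e' k a = w a" using s(1) unfolding e'k_ip wv by (simp add: e'k)
      then show ?thesis using True by (simp add: e'i w_def)
    next
      case False
      then have u: "u \<in> V" using that by simp
      \<comment> \<open>Vectors treated earlier lie in the span of the old system, to which
        \<open>w\<close> is orthogonal. Their expansions survive with new coefficient 0.\<close>
      have "ip m w u = ip m w (\<lambda>a. \<Sum>i<k. ip m (e i) u * e i a)"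
        by (rule ip_cong) (use rep[OF u] in auto)
      also have "\<dots> = 0" by (simp add: ip_sum_right ip_scale_right we)
      finally show ?thesis using rep[OF u \<open>a < m\<close>] by (simp add: e'k_ip e'i)
    qed
    show ?thesis
      using k orth' rep' insert.hyps by (intro exI[of _ "Suc k"] exI[of _ e']) auto
  qed
qed

text \<open>Take a maximal linearly independent set of columns. A column outside its span could be
  added to it, against maximality.\<close>

lemma (in vec_space) column_basis_exists:
  assumes A: "A \<in> carrier_mat n nc"
  shows "\<exists>U. U \<subseteq> set (cols A) \<and> card U = rank A \<and> set (cols A) \<subseteq> span U"
proof -
  let ?P = "\<lambda>T. T \<subseteq> set (cols A) \<and> lin_indpt T"
  have C: "set (cols A) \<subseteq> carrier_vec n" using cols_dim A by blast
  have "lin_indpt {}" unfolding lin_dep_def by auto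
  then obtain U where U: "maximal U ?P"
    using maximal_exists_superset[of "set (cols A)" ?P "{}"] by blast
  then have li: "lin_indpt U" and sub: "U \<subseteq> set (cols A)" by (auto simp: maximal_def)
  have "s \<in> span U" if s: "s \<in> set (cols A)" for s
  proof (rule ccontr)
    assume n: "s \<notin> span U"
    have U': "U \<subseteq> carrier_vec n" and s': "s \<in> carrier_vec n" using sub s C by auto
    have "s \<notin> U" using n span_mem[of U s] U' by auto
    moreover have "lin_indpt (U \<union> {s})"
      using lin_dep_iff_in_span[of U s] n li U' s' \<open>s \<notin> U\<close> by simp
    moreover have "U \<union> {s} \<subseteq> set (cols A)" using s sub by simp
    ultimately show False using U unfolding maximal_def by (metis Un_upper1 insertI1 Un_iff)
  qed
  then show ?thesis using rank_card_indpt[OF A U] sub by (intro exI[of _ U]) auto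
qed

text \<open>With \<open>e\<close> an orthonormal basis of the column space, \<open>x a\<close>
  collects the entries of the basis vectors in row \<open>a\<close> and \<open>y b\<close> the
  coordinates of column \<open>b\<close>. Summing the norms of the rows counts \<open>k\<close> unit
  vectors; the norm of \<open>y b\<close> is Parseval's identity.\<close>

lemma rank_factorization:
  fixes M :: "real mat"
  assumes M: "M \<in> carrier_mat m n"
  shows "\<exists>k x y. k \<le> vec_space.rank m M \<and>
    (\<forall>a<m. \<forall>b<n. M $$ (a, b) = ip k (x a) (y b)) \<and>
    (\<Sum>a<m. ip k (x a) (x a)) = real k \<and>
    (\<forall>b<n. ip k (y b) (y b) = (\<Sum>a<m. (M $$ (a, b))\<^sup>2))"
proof -
  interpret vec_space "TYPE(real)" m .
  obtain U where U: "U \<subseteq> set (cols M)" "card U = rank M" "set (cols M) \<subseteq> span U"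
    using column_basis_exists[OF M] by blast
  have C: "set (cols M) \<subseteq> carrier_vec m" using cols_dim M by blast
  have fU: "finite U" using U(1) finite_subset by blast
  define V where "V = (\<lambda>u a. u $ a) ` U"
  obtain k e where k: "k \<le> card V"
    and orth: "\<And>i j. i < k \<Longrightarrow> j < k \<Longrightarrow> ip m (e i) (e j) = (if i = j then 1 else 0)"
    and rep: "\<And>u a. u \<in> V \<Longrightarrow> a < m \<Longrightarrow> u a = (\<Sum>i<k. ip m (e i) u * e i a)"
    using orthonormal_system_exists[of V m] fU unfolding V_def by blast
  define c where "c b a = M $$ (a, b)" for a b
  \<comment> \<open>\<open>V\<close> contains only the columns in \<open>U\<close>; every other
    column is a linear combination of these and inherits the expansion.\<close>
  have rep_c: "c b a = (\<Sum>i<k. ip m (e i) (c b) * e i a)" if "a < m" "b < n" for a b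
  proof -
    have "col M b \<in> set (cols M)" using M that by (auto simp: cols_def)
    then have "col M b \<in> span U" using U by blast
    then obtain f W where W: "finite W" "W \<subseteq> U" "col M b = lincomb f W"
      unfolding span_def by blast
    have cW: "c b a' = (\<Sum>u\<in>W. f u * (u $ a'))" if "a' < m" for a'
    proof -
      have "c b a' = col M b $ a'" using M that \<open>b < n\<close> by (simp add: c_def)
      also have "\<dots> = (\<Sum>u\<in>W. f u * (u $ a'))"
        unfolding W(3) using W(2) U(1) C that by (intro lincomb_index) auto
      finally show ?thesis .
    qed
    have ec: "ip m (e i) (c b) = (\<Sum>u\<in>W. f u * ip m (e i) (\<lambda>a. u $ a))" for i
    proof -
      have "ip m (e i) (c b) = ip m (e i) (\<lambda>a. \<Sum>u\<in>W. f u * (u $ a))"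
        by (rule ip_cong) (use cW in auto)
      then show ?thesis by (simp add: ip_sum_right ip_scale_right)
    qed
    have "c b a = (\<Sum>u\<in>W. f u * (\<Sum>i<k. ip m (e i) (\<lambda>a. u $ a) * e i a))"
      unfolding cW[OF \<open>a < m\<close>]
      by (intro sum.cong refl arg_cong2[where f = "(*)"] rep) (use W(2) \<open>a < m\<close> in \<open>auto simp: V_def\<close>)
    also have "\<dots> = (\<Sum>i<k. \<Sum>u\<in>W. f u * (ip m (e i) (\<lambda>a. u $ a) * e i a))"
      unfolding sum_distrib_left by (rule sum.swap)
    also have "\<dots> = (\<Sum>i<k. ip m (e i) (c b) * e i a)"
      unfolding ec sum_distrib_right by (simp add: mult.assoc)
    finally show ?thesis .
  qed
  show ?thesis
  proof (rule exI[of _ k], rule exI[of _ "\<lambda>a i. e i a"], rule exI[of _ "\<lambda>b i. ip m (e i) (c b)"],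
      intro conjI allI impI)
    show "k \<le> vec_space.rank m M"
      using k U(2) card_image_le[OF fU, of "\<lambda>u a. u $ a"] unfolding V_def by simp
    show "M $$ (a, b) = ip k (\<lambda>i. e i a) (\<lambda>i. ip m (e i) (c b))" if "a < m" "b < n" for a b
      using rep_c[OF that] by (simp add: c_def ip_def[of k] mult.commute)
    have "(\<Sum>a<m. ip k (\<lambda>i. e i a) (\<lambda>i. e i a)) = (\<Sum>i<k. ip m (e i) (e i))"
      unfolding ip_def by (rule sum.swap)
    then show "(\<Sum>a<m. ip k (\<lambda>i. e i a) (\<lambda>i. e i a)) = real k" by (simp add: orth)
    fix b assume b: "b < n"
    have "(\<Sum>a<m. (M $$ (a, b))\<^sup>2) = ip m (c b) (c b)"
      by (simp add: ip_def c_def power2_eq_square)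
    also have "\<dots> = ip m (c b) (\<lambda>a. \<Sum>i<k. ip m (e i) (c b) * e i a)"
      by (rule ip_cong) (use rep_c b in auto)
    also have "\<dots> = (\<Sum>i<k. ip m (e i) (c b) * ip m (e i) (c b))"
      by (simp add: ip_sum_right ip_scale_right ip_commute[of m "c b"])
    finally show "ip k (\<lambda>i. ip m (e i) (c b)) (\<lambda>i. ip m (e i) (c b)) = (\<Sum>a<m. (M $$ (a, b))\<^sup>2)"
      by (simp add: ip_def[of k])
  qed
qed

section \<open>Bilinear forms on the cube and rectangle sums\<close>

text \<open>The form is linear in \<open>u\<close> and in \<open>v\<close> separately, so each can
  be rounded to the indicator of the indices with positive coefficient: first \<open>u\<close>,
  giving \<open>X\<close>, then \<open>v\<close> with \<open>X\<close> fixed, giving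
  \<open>Y\<close>.\<close>

lemma sum_prod_box_le:
  fixes B :: "nat \<Rightarrow> nat \<Rightarrow> real"
  assumes D: "\<And>X Y. X \<subseteq> {..<m} \<Longrightarrow> Y \<subseteq> {..<n} \<Longrightarrow> (\<Sum>a\<in>X. \<Sum>b\<in>Y. B a b) \<le> D"
    and u: "\<And>a. 0 \<le> u a \<and> u a \<le> 1" and v: "\<And>b. 0 \<le> v b \<and> v b \<le> 1"
  shows "(\<Sum>a<m. \<Sum>b<n. B a b * (u a * v b)) \<le> D"
proof -
  have lin: "(\<Sum>a\<in>A. f a * c a) \<le> (\<Sum>a\<in>{a\<in>A. c a > 0}. c a)"
    if "finite A" and f: "\<And>a. 0 \<le> f a \<and> f a \<le> (1::real)" for A :: "nat set" and f c
  proof -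
    have "f a * c a \<le> (if c a > 0 then c a else 0)" for a
      using f[of a] mult_right_mono[of "f a" 1 "c a"] mult_nonneg_nonpos[of "f a" "c a"] by auto
    then have "(\<Sum>a\<in>A. f a * c a) \<le> (\<Sum>a\<in>A. if c a > 0 then c a else 0)" by (intro sum_mono)
    also have "\<dots> = (\<Sum>a\<in>{a\<in>A. c a > 0}. c a)" using that by (simp add: sum.inter_filter)
    finally show ?thesis .
  qed
  define X where "X = {a\<in>{..<m}. (\<Sum>b<n. B a b * v b) > 0}"
  define Y where "Y = {b\<in>{..<n}. (\<Sum>a\<in>X. B a b) > 0}"
  have "(\<Sum>a<m. \<Sum>b<n. B a b * (u a * v b)) = (\<Sum>a<m. u a * (\<Sum>b<n. B a b * v b))"
    by (simp add: sum_distrib_left mult_ac)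
  also have "\<dots> \<le> (\<Sum>a\<in>X. \<Sum>b<n. B a b * v b)"
    unfolding X_def by (rule lin) (use u in auto)
  also have "\<dots> = (\<Sum>b<n. v b * (\<Sum>a\<in>X. B a b))"
    by (subst sum.swap) (simp add: sum_distrib_left mult_ac)
  also have "\<dots> \<le> (\<Sum>b\<in>Y. \<Sum>a\<in>X. B a b)"
    unfolding Y_def by (rule lin) (use v in auto)
  also have "\<dots> = (\<Sum>a\<in>X. \<Sum>b\<in>Y. B a b)" by (rule sum.swap)
  also have "\<dots> \<le> D" by (rule D) (auto simp: X_def Y_def)
  finally show ?thesis .
qed

text \<open>Splitting \<open>u\<close> and \<open>v\<close> into positive and negative parts yields
  four forms on the unit box. Two of them enter with a minus sign, hence the two-sided bound on
  rectangle sums.\<close>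

lemma sum_prod_cube_le:
  fixes B :: "nat \<Rightarrow> nat \<Rightarrow> real"
  assumes D: "\<And>X Y. X \<subseteq> {..<m} \<Longrightarrow> Y \<subseteq> {..<n} \<Longrightarrow> \<bar>\<Sum>a\<in>X. \<Sum>b\<in>Y. B a b\<bar> \<le> D"
    and u: "\<And>a. \<bar>u a\<bar> \<le> 1" and v: "\<And>b. \<bar>v b\<bar> \<le> 1"
  shows "(\<Sum>a<m. \<Sum>b<n. B a b * (u a * v b)) \<le> 4 * D"
proof -
  define F where "F u v = (\<Sum>a<m. \<Sum>b<n. B a b * (u a * v b))" for u v
  have pos: "F u v \<le> D" if "\<And>a. 0 \<le> u a \<and> u a \<le> 1" "\<And>b. 0 \<le> v b \<and> v b \<le> 1" for u v
    unfolding F_def by (rule sum_prod_box_le) (use D abs_le_D1 that in blast)+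
  have neg: "- F u v \<le> D" if "\<And>a. 0 \<le> u a \<and> u a \<le> 1" "\<And>b. 0 \<le> v b \<and> v b \<le> 1" for u v
  proof -
    have "(\<Sum>a<m. \<Sum>b<n. - B a b * (u a * v b)) \<le> D"
    proof (rule sum_prod_box_le)
      show "(\<Sum>a\<in>X. \<Sum>b\<in>Y. - B a b) \<le> D" if "X \<subseteq> {..<m}" "Y \<subseteq> {..<n}" for X Y
        using abs_le_D2[OF D[OF that]] by (simp add: sum_negf)
    qed (use that in auto)
    then show ?thesis by (simp add: F_def sum_negf)
  qed
  define p where "p f a = max 0 (f a :: real)" for f and a :: nat
  have split: "f a = p f a - p (\<lambda>a. - f a) a" for f a by (simp add: p_def max_def)
  have p: "0 \<le> p f a \<and> p f a \<le> 1" if "\<And>a. \<bar>f a\<bar> \<le> 1" for f a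
    using that[of a] by (auto simp: p_def)
  have "B a b * (u a * v b) = B a b * (p u a * p v b) + B a b * (p (\<lambda>a. - u a) a * p (\<lambda>b. - v b) b)
      - B a b * (p u a * p (\<lambda>b. - v b) b) - B a b * (p (\<lambda>a. - u a) a * p v b)" for a b
    by (subst split[of u a], subst split[of v b]) (simp add: algebra_simps)
  then have "F u v = F (p u) (p v) + F (p (\<lambda>a. - u a)) (p (\<lambda>b. - v b))
      - F (p u) (p (\<lambda>b. - v b)) - F (p (\<lambda>a. - u a)) (p v)"
    unfolding F_def by (simp add: sum.distrib sum_subtractf)
  also have "\<dots> \<le> D + D + D + D"
    using pos[of "p u" "p v"] pos[of "p (\<lambda>a. - u a)" "p (\<lambda>b. - v b)"]
      neg[of "p u" "p (\<lambda>b. - v b)"] neg[of "p (\<lambda>a. - u a)" "p v"] p[of u] p[of v]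
      p[of "\<lambda>a. - u a"] p[of "\<lambda>b. - v b"] u v by auto
  finally show ?thesis by (simp add: F_def)
qed

section \<open>Rademacher sums and their moments\<close>

text \<open>The Rademacher sum of \<open>x 0, \<dots>, x (N - 1)\<close> at the sample point \<open>w < 2 ^ N\<close>: bit \<open>i\<close> of
  \<open>w\<close> is the sign of \<open>x i\<close>, with 0 for plus.\<close>

fun rad :: "nat \<Rightarrow> (nat \<Rightarrow> real) \<Rightarrow> nat \<Rightarrow> real" where
  "rad 0 x w = 0"
| "rad (Suc N) x w = (if w < 2 ^ N then rad N x w + x N else rad N x (w - 2 ^ N) - x N)"

lemma sum_lessThan_double:
  fixes f :: "nat \<Rightarrow> real"
  shows "(\<Sum>w<2 ^ Suc N. f w) = (\<Sum>w<2 ^ N. f w + f (w + 2 ^ N))"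
proof -
  have "(\<Sum>w<k + l. f w) = (\<Sum>w<k. f w) + (\<Sum>w<l. f (w + k))" for k l
    by (induction l) (simp_all add: ac_simps)
  from this[of "2 ^ N" "2 ^ N"] show ?thesis by (simp add: sum.distrib mult_2)
qed

text \<open>Independent signs are uncorrelated: summing over the last bit cancels the mixed terms.
  Thus inner products become covariances of scalar random variables.\<close>

lemma sum_rad_mult: "(\<Sum>w<2 ^ N. rad N x w * rad N y w) = 2 ^ N * ip N x y"
proof (induction N)
  case (Suc N)
  have "(\<Sum>w<2 ^ Suc N. rad (Suc N) x w * rad (Suc N) y w)
      = (\<Sum>w<2 ^ N. 2 * (rad N x w * rad N y w) + 2 * (x N * y N))"
    unfolding sum_lessThan_double by (intro sum.cong) (auto simp: algebra_simps)
  also have "\<dots> = 2 * (\<Sum>w<2 ^ N. rad N x w * rad N y w) + 2 ^ N * (2 * (x N * y N))"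
    by (simp add: sum.distrib sum_distrib_left)
  finally show ?case unfolding Suc.IH by (simp add: ip_def algebra_simps)
qed (simp add: ip_def)

text \<open>The fourth-moment case of Khintchine's inequality; odd powers of the last term cancel
  between its two signs.\<close>

lemma sum_rad_power4_le: "(\<Sum>w<2 ^ N. rad N x w ^ 4) \<le> 3 * 2 ^ N * (ip N x x)\<^sup>2"
proof (induction N)
  case (Suc N)
  have "(r + t) ^ 4 + (r - t) ^ 4 = 2 * r ^ 4 + 12 * t\<^sup>2 * (r * r) + 2 * t ^ 4" for r t :: real
    by (simp add: power4_eq_xxxx power2_eq_square algebra_simps)
  then have "(\<Sum>w<2 ^ Suc N. rad (Suc N) x w ^ 4)
      = (\<Sum>w<2 ^ N. 2 * rad N x w ^ 4 + 12 * (x N)\<^sup>2 * (rad N x w * rad N x w) + 2 * x N ^ 4)"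
    unfolding sum_lessThan_double by (intro sum.cong) auto
  also have "\<dots> = 2 * (\<Sum>w<2 ^ N. rad N x w ^ 4)
      + 12 * (x N)\<^sup>2 * (\<Sum>w<2 ^ N. rad N x w * rad N x w) + 2 ^ N * (2 * x N ^ 4)"
    by (simp add: sum.distrib flip: sum_distrib_left)
  \<comment> \<open>The coefficient 2 of the last term is raised to 6 to complete the
    square.\<close>
  also have "\<dots> \<le> 2 * (3 * 2 ^ N * (ip N x x)\<^sup>2) + 12 * (x N)\<^sup>2 * (2 ^ N * ip N x x) + 2 ^ N * (6 * x N ^ 4)"
    unfolding sum_rad_mult using Suc.IH by (intro add_mono mult_left_mono) auto
  also have "\<dots> = 3 * 2 ^ Suc N * (ip N x x + x N * x N)\<^sup>2"
    by (simp add: power2_eq_square power4_eq_xxxx algebra_simps)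
  finally show ?case by (simp add: ip_def)
qed simp

section \<open>Truncation and Grothendieck's inequality\<close>

definition clamp :: "real \<Rightarrow> real" where
  "clamp t = max (- 4) (min 4 t)"

lemma abs_clamp_le: "\<bar>clamp t\<bar> \<le> 4"
  by (auto simp: clamp_def)

lemma clamp_square_le: "(clamp t)\<^sup>2 \<le> t\<^sup>2"
  by (rule abs_le_square_iff[THEN iffD1]) (auto simp: clamp_def)

text \<open>The tail vanishes unless \<open>t\<close> exceeds 4 in absolute value, and then its
  square is at most \<open>t\<^sup>2\<close>, while 16 is at most \<open>t\<^sup>2\<close>.\<close>

lemma clamp_tail_square_le: "(t - clamp t)\<^sup>2 \<le> t ^ 4 / 16"
proof (cases "\<bar>t\<bar> \<le> 4")
  case True
  then have "clamp t = t" by (auto simp: clamp_def)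
  then show ?thesis by simp
next
  case False
  then have "\<bar>t - clamp t\<bar> \<le> \<bar>t\<bar>" "4\<^sup>2 \<le> t\<^sup>2"
    using abs_le_square_iff[of 4 t] by (auto simp: clamp_def)
  then have "(t - clamp t)\<^sup>2 \<le> t\<^sup>2" "16 * t\<^sup>2 \<le> t\<^sup>2 * t\<^sup>2"
    using abs_le_square_iff[of "t - clamp t" t] mult_right_mono[of "4\<^sup>2" "t\<^sup>2" "t\<^sup>2"] by simp_all
  moreover have "t ^ 4 = t\<^sup>2 * t\<^sup>2" by (simp flip: power_add)
  ultimately show ?thesis by linarith
qed

lemma abs_ip_le:
  assumes "ip N x x \<le> 1" "ip N y y \<le> 1"
  shows "\<bar>ip N x y\<bar> \<le> 1"
proof -
  have "0 \<le> ip N (\<lambda>i. x i - y i) (\<lambda>i. x i - y i)" "0 \<le> ip N (\<lambda>i. x i + y i) (\<lambda>i. x i + y i)"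
    by (rule ip_self_nonneg)+
  moreover have "ip N (\<lambda>i. x i - y i) (\<lambda>i. x i - y i) = ip N x x + ip N y y - 2 * ip N x y"
    "ip N (\<lambda>i. x i + y i) (\<lambda>i. x i + y i) = ip N x x + ip N y y + 2 * ip N x y"
    by (simp_all add: ip_def algebra_simps sum.distrib sum_subtractf sum_distrib_left)
  ultimately show ?thesis using assms by linarith
qed

text \<open>Realise the inner products by Rademacher sums and truncate these at 4. The fourth moment makes
  the squared norm of each tail at most \<open>3 / 16 \<le> (7 / 16)\<^sup>2\<close>, so the two tail terms are absorbed
  into 7/8 of the supremum \<open>S\<close> over all vector systems.\<close>

lemma grothendieck_inequality:
  fixes B :: "nat \<Rightarrow> nat \<Rightarrow> real"
  assumes D: "\<And>u v. (\<And>a. \<bar>u a\<bar> \<le> 1) \<Longrightarrow> (\<And>b. \<bar>v b\<bar> \<le> 1) \<Longrightarrow>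
      (\<Sum>a<m. \<Sum>b<n. B a b * (u a * v b)) \<le> D"
    and x: "\<And>a. ip N (x a) (x a) \<le> 1" and y: "\<And>b. ip N (y b) (y b) \<le> 1"
  shows "(\<Sum>a<m. \<Sum>b<n. B a b * ip N (x a) (y b)) \<le> 128 * D"
proof -
  define G where "G N x y = (\<Sum>a<m. \<Sum>b<n. B a b * ip N (x a) (y b))" for N x y
  \<comment> \<open>The dimension varies within \<open>K\<close>, because the argument below passes
    from dimension \<open>N\<close> to dimension \<open>2 ^ N\<close>.\<close>
  define K where "K = {G N x y | N x y. (\<forall>a. ip N (x a) (x a) \<le> 1) \<and> (\<forall>b. ip N (y b) (y b) \<le> 1)}"
  define S where "S = Sup K"
  \<comment> \<open>Only a finite supremum can be absorbed at the end.\<close>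
  have bdd: "bdd_above K"
  proof (rule bdd_aboveI[of _ "\<Sum>a<m. \<Sum>b<n. \<bar>B a b\<bar>"])
    fix t assume "t \<in> K"
    then obtain N x y where t: "t = G N x y"
      and xy: "\<And>a. ip N (x a) (x a) \<le> 1" "\<And>b. ip N (y b) (y b) \<le> 1" unfolding K_def by blast
    have "B a b * ip N (x a) (y b) \<le> \<bar>B a b\<bar>" for a b
    proof -
      have "\<bar>B a b * ip N (x a) (y b)\<bar> \<le> \<bar>B a b\<bar> * 1"
        unfolding abs_mult by (intro mult_left_mono abs_ip_le xy) auto
      then show ?thesis by linarith
    qed
    then show "t \<le> (\<Sum>a<m. \<Sum>b<n. \<bar>B a b\<bar>)" unfolding t G_def by (intro sum_mono)
  qed
  have le_S: "G N x y \<le> S" if "\<And>a. ip N (x a) (x a) \<le> 1" "\<And>b. ip N (y b) (y b) \<le> 1" for N x y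
    unfolding S_def by (rule cSup_upper[OF _ bdd]) (use that in \<open>auto simp: K_def\<close>)
  \<comment> \<open>Stretching the short vectors by 16/7 keeps them in the unit ball, since 3/16 *
    (16/7)^2 = 48/49.\<close>
  have tail: "G N x y \<le> 7 / 16 * S"
    if x: "\<And>a. ip N (x a) (x a) \<le> 3 / 16" and y: "\<And>b. ip N (y b) (y b) \<le> 1" for N x y
  proof -
    have "G N (\<lambda>a i. 16 / 7 * x a i) y \<le> S"
    proof (rule le_S)
      show "ip N (\<lambda>i. 16 / 7 * x a i) (\<lambda>i. 16 / 7 * x a i) \<le> 1" for a
        unfolding ip_scale_left ip_scale_right using x[of a] by simp
    qed (rule y)
    moreover have "G N (\<lambda>a i. 16 / 7 * x a i) y = 16 / 7 * G N x y"
      unfolding G_def ip_scale_left by (simp only: sum_distrib_left mult.left_commute)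
    ultimately show ?thesis by simp
  qed
  have tail': "G N x y \<le> 7 / 16 * S"
    if x: "\<And>a. ip N (x a) (x a) \<le> 1" and y: "\<And>b. ip N (y b) (y b) \<le> 3 / 16" for N x y
  proof -
    have "G N x (\<lambda>a i. 16 / 7 * y a i) \<le> S"
    proof (rule le_S)
      show "ip N (\<lambda>i. 16 / 7 * y a i) (\<lambda>i. 16 / 7 * y a i) \<le> 1" for a
        unfolding ip_scale_left ip_scale_right using y[of a] by simp
    qed (rule x)
    moreover have "G N x (\<lambda>a i. 16 / 7 * y a i) = 16 / 7 * G N x y"
      unfolding G_def ip_scale_right by (simp only: sum_distrib_left mult.left_commute)
    ultimately show ?thesis by simp
  qed
  have boot: "G N x y \<le> 16 * D + 7 / 8 * S"
    if x: "\<And>a. ip N (x a) (x a) \<le> 1" and y: "\<And>b. ip N (y b) (y b) \<le> 1" for N x y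
  proof -
    define L :: nat where "L = 2 ^ N"
    define s where "s = sqrt (real L)"
    have L: "real L > 0" "real L = 2 ^ N" by (auto simp: L_def)
    have s: "s > 0" "s * s = real L" using L by (auto simp: s_def)
    \<comment> \<open>Division by \<open>s\<close> makes \<open>ip L\<close> the average over all
      sample points, so a random variable is a vector whose squared norm is its second
      moment.\<close>
    have ip_div: "ip L (\<lambda>w. f w / s) (\<lambda>w. g w / s) = (\<Sum>w<L. f w * g w) / real L" for f g
      using s by (simp add: ip_def sum_divide_distrib flip: s(2))
    define R where "R z w = rad N z w / s" for z w
    define C where "C z w = clamp (rad N z w) / s" for z w
    define T where "T z w = (rad N z w - clamp (rad N z w)) / s" for z w
    have ip_R: "ip L (R z) (R z') = ip N z z'" for z z'
      unfolding R_def ip_div using L by (simp add: L_def sum_rad_mult)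
    have ip_C: "ip L (C z) (C z) \<le> 1" if "ip N z z \<le> 1" for z
    proof -
      have "ip L (C z) (C z) \<le> ip L (R z) (R z)"
        unfolding C_def R_def ip_div
        using clamp_square_le L by (intro divide_right_mono sum_mono) (auto simp: power2_eq_square)
      then show ?thesis using that by (simp add: ip_R)
    qed
    have ip_T: "ip L (T z) (T z) \<le> 3 / 16" if z: "ip N z z \<le> 1" for z
    proof -
      have "ip L (T z) (T z) \<le> (\<Sum>w<L. rad N z w ^ 4 / 16) / real L"
        unfolding T_def ip_div
        using clamp_tail_square_le L by (intro divide_right_mono sum_mono) (auto simp: power2_eq_square)
      also have "\<dots> = (\<Sum>w<2 ^ N. rad N z w ^ 4) / (16 * real L)"
        by (simp add: L_def flip: sum_divide_distrib)
      also have "\<dots> \<le> (3 * 2 ^ N * (ip N z z)\<^sup>2) / (16 * real L)"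
        using L by (intro divide_right_mono sum_rad_power4_le) auto
      also have "\<dots> = 3 / 16 * (ip N z z)\<^sup>2" using L by simp
      also have "\<dots> \<le> 3 / 16"
        using power_le_one[OF ip_self_nonneg z, of 2] by simp
      finally show ?thesis .
    qed
    have swap: "(\<Sum>a<m. \<Sum>b<n. \<Sum>w<L. f a b w) = (\<Sum>w<L. \<Sum>a<m. \<Sum>b<n. f a b w)"
      for f :: "nat \<Rightarrow> nat \<Rightarrow> nat \<Rightarrow> real"
    proof -
      have "(\<Sum>a<m. \<Sum>b<n. \<Sum>w<L. f a b w) = (\<Sum>a<m. \<Sum>w<L. \<Sum>b<n. f a b w)"
        by (intro sum.cong refl sum.swap)
      also have "\<dots> = (\<Sum>w<L. \<Sum>a<m. \<Sum>b<n. f a b w)" by (rule sum.swap)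
      finally show ?thesis .
    qed
    \<comment> \<open>At each fixed sample point the clamped values divided by 4 are admissible in
      \<open>D\<close>, which costs a factor 4 * 4.\<close>
    have main: "G L (\<lambda>a. C (x a)) (\<lambda>b. C (y b)) \<le> 16 * D"
    proof -
      have "G L (\<lambda>a. C (x a)) (\<lambda>b. C (y b)) = (\<Sum>w<L. \<Sum>a<m. \<Sum>b<n. B a b *
          (clamp (rad N (x a) w) * clamp (rad N (y b) w)) / real L)"
        unfolding G_def C_def ip_div swap[symmetric]
        by (simp add: sum_distrib_left sum_divide_distrib)
      also have "\<dots> \<le> (\<Sum>w<L. 16 * D / real L)"
      proof (intro sum_mono)
        fix w
        have "(\<Sum>a<m. \<Sum>b<n. B a b * (clamp (rad N (x a) w) / 4 * (clamp (rad N (y b) w) / 4))) \<le> D"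
          by (rule D) (use abs_clamp_le in auto)
        then have "(\<Sum>a<m. \<Sum>b<n. B a b * (clamp (rad N (x a) w) * clamp (rad N (y b) w))) \<le> 16 * D"
          by (simp flip: sum_divide_distrib)
        then show "(\<Sum>a<m. \<Sum>b<n. B a b * (clamp (rad N (x a) w) * clamp (rad N (y b) w)) / real L)
            \<le> 16 * D / real L"
          using L by (simp add: divide_right_mono flip: sum_divide_distrib)
      qed
      also have "\<dots> = 16 * D" using L by simp
      finally show ?thesis .
    qed
    \<comment> \<open>Since \<open>R = C + T\<close>, leaving one factor \<open>R\<close> whole
      merges two of the error terms, and only two tail terms remain.\<close>
    have "ip N z z' = ip L (C z) (C z') + ip L (T z) (R z') + ip L (C z) (T z')" for z z'
    proof -
      have "ip L (R z) (R z') = ip L (C z) (C z') + ip L (T z) (R z') + ip L (C z) (T z')"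
        unfolding R_def C_def T_def ip_div add_divide_distrib[symmetric] sum.distrib[symmetric]
        by (simp add: algebra_simps)
      then show ?thesis by (simp add: ip_R)
    qed
    then have "G N x y = G L (\<lambda>a. C (x a)) (\<lambda>b. C (y b)) + G L (\<lambda>a. T (x a)) (\<lambda>b. R (y b))
        + G L (\<lambda>a. C (x a)) (\<lambda>b. T (y b))"
      unfolding G_def by (simp add: distrib_left sum.distrib)
    also have "\<dots> \<le> 16 * D + 7 / 16 * S + 7 / 16 * S"
      by (intro add_mono main tail tail' ip_T ip_C x y) (simp add: ip_R y)
    finally show ?thesis by simp
  qed
  have "S \<le> 16 * D + 7 / 8 * S"
    unfolding S_def
  proof (rule cSup_least)
    have "G 0 (\<lambda>_ _. 0) (\<lambda>_ _. 0) \<in> K" unfolding K_def by (force simp: ip_def)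
    then show "K \<noteq> {}" by blast
  qed (use boot in \<open>auto simp: K_def S_def\<close>)
  then have "S \<le> 128 * D" by simp
  moreover have "G N x y \<le> S" by (rule le_S) (rule x y)+
  ultimately show ?thesis by (simp add: G_def)
qed

section \<open>The lower bound from a factorization\<close>

text \<open>\<open>D\<close> is any bound on the centred rectangle sums, so matrices and rank enter
  only through the factorization.\<close>

lemma discrepancy_lower_bound:
  fixes A :: "nat \<Rightarrow> nat \<Rightarrow> real"
  assumes m: "m > 0" and n: "n > 0" and r: "r > 0" "k \<le> r"
    and A: "\<And>a b. a < m \<Longrightarrow> b < n \<Longrightarrow> A a b = 0 \<or> A a b = 1"
    and p: "(\<Sum>a<m. \<Sum>b<n. A a b) = p * real m * real n" "0 < p" "p \<le> 1/2"
    and D: "\<And>X Y. X \<subseteq> {..<m} \<Longrightarrow> Y \<subseteq> {..<n} \<Longrightarrow> \<bar>\<Sum>a\<in>X. \<Sum>b\<in>Y. A a b - p\<bar> \<le> D"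
    and xy: "\<And>a b. a < m \<Longrightarrow> b < n \<Longrightarrow> A a b = ip k (x a) (y b)"
    and x: "(\<Sum>a<m. ip k (x a) (x a)) = real k"
    and y: "\<And>b. b < n \<Longrightarrow> ip k (y b) (y b) = (\<Sum>a<m. (A a b)\<^sup>2)"
  shows "1 / 53248 * real m * real n * min p (sqrt p / sqrt (real r)) \<le> D"
proof (cases "p * real m * real n / 16 \<le> D")
  case True
  have "1 / 53248 * real m * real n * min p (sqrt p / sqrt (real r)) \<le> 1 / 53248 * real m * real n * p"
    by (intro mult_left_mono) auto
  also have "\<dots> \<le> p * real m * real n / 16" using p by (simp add: field_simps)
  finally show ?thesis using True by simp
next
  \<comment> \<open>From here on \<open>D\<close> is below a sixteenth of the number of ones, which
    keeps the losses from deleted rows and columns small.\<close>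
  case False
  have mn: "real m > 0" "real n > 0" using m n by auto
  define s where "s = sqrt (real m)"
  have s: "s > 0" "s * s = real m" using mn by (auto simp: s_def)
  \<comment> \<open>The extra coordinates multiply to \<open>-p\<close>. The scaling by
    \<open>s\<close> balances them: the row norms grow by 1 in total, and each column norm by
    \<open>p\<^sup>2 * m\<close>, at most \<open>p * m\<close>.\<close>
  define x' where "x' a i = (if i < k then x a i else 1 / s)" for a i
  define y' where "y' b i = (if i < k then y b i else - p * s)" for b i
  have split: "ip (Suc k) f g = ip k f g + f k * g k" for f g
    by (simp add: ip_def)
  have xy': "ip (Suc k) (x' a) (y' b) = A a b - p" if "a < m" "b < n" for a b
  proof -
    have "ip k (x' a) (y' b) = ip k (x a) (y b)" by (simp add: ip_def x'_def y'_def)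
    then show ?thesis using s xy[OF that] by (simp add: split) (simp add: x'_def y'_def)
  qed
  have x': "ip (Suc k) (x' a) (x' a) = ip k (x a) (x a) + 1 / real m" for a
  proof -
    have "ip k (x' a) (x' a) = ip k (x a) (x a)" by (simp add: ip_def x'_def)
    then show ?thesis using s by (simp add: split) (simp add: x'_def)
  qed
  define deg where "deg b = (\<Sum>a<m. A a b)" for b
  have y': "ip (Suc k) (y' b) (y' b) = deg b + p\<^sup>2 * real m" if "b < n" for b
  proof -
    have "(\<Sum>a<m. (A a b)\<^sup>2) = deg b"
      unfolding deg_def using A[OF _ that] by (intro sum.cong) (auto simp: power2_eq_square)
    moreover have "ip k (y' b) (y' b) = ip k (y b) (y b)" by (simp add: ip_def y'_def)
    ultimately show ?thesis
      using y[OF that] by (simp add: split) (simp add: y'_def power2_eq_square flip: s(2))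
  qed
  \<comment> \<open>The thresholds are 16 times a bound on the average row norm and 4 times the
    average column degree. By Markov's inequality at most \<open>m / 16\<close> rows are
    bad.\<close>
  define I where "I = {a\<in>{..<m}. ip (Suc k) (x' a) (x' a) \<le> 16 * real (Suc k) / real m}"
  define J where "J = {b\<in>{..<n}. deg b \<le> 4 * p * real m}"
  define I' where "I' = {..<m} - I"
  define J' where "J' = {..<n} - J"
  have sub: "I \<subseteq> {..<m}" "J \<subseteq> {..<n}" "I' \<subseteq> {..<m}" "J' \<subseteq> {..<n}"
    by (auto simp: I_def J_def I'_def J'_def)
  have fin: "finite I" "finite J" "finite I'" "finite J'"
    by (auto simp: I_def J_def I'_def J'_def)
  have A0: "0 \<le> A a b" if "a < m" "b < n" for a b using A[OF that] by auto
  have ones: "(\<Sum>a\<in>X. \<Sum>b\<in>Y. A a b) \<le> p * real (card X) * real (card Y) + D"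
    if "X \<subseteq> {..<m}" "Y \<subseteq> {..<n}" for X Y
    using abs_le_D1[OF D[OF that]] by (simp add: sum_subtractf mult_ac)
  have "real (card I') * (16 * real (Suc k) / real m) = (\<Sum>a\<in>I'. 16 * real (Suc k) / real m)"
    by simp
  also have "\<dots> \<le> (\<Sum>a\<in>I'. ip (Suc k) (x' a) (x' a))"
    by (rule sum_mono) (auto simp: I'_def I_def)
  also have "\<dots> \<le> (\<Sum>a<m. ip (Suc k) (x' a) (x' a))"
    by (rule sum_mono2) (use sub ip_self_nonneg in auto)
  also have "\<dots> = real (Suc k)" using mn x by (simp add: x' sum.distrib)
  finally have "real (card I') * 16 / real m * real (Suc k) \<le> 1 * real (Suc k)"
    by (simp add: mult_ac del: of_nat_Suc)
  then have "real (card I') * 16 / real m \<le> 1" by (rule mult_right_le_imp_le) simp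
  then have card_I': "real (card I') \<le> real m / 16" using mn by (simp add: field_simps)
  have bad_rows: "(\<Sum>a\<in>I'. \<Sum>b<n. A a b) \<le> p * real m * real n / 16 + D"
  proof -
    have "p * real (card I') * real n \<le> p * (real m / 16) * real n"
      using card_I' p mn by (intro mult_right_mono mult_left_mono) auto
    then show ?thesis using ones[OF sub(3), of "{..<n}"] by simp
  qed
  \<comment> \<open>Bad columns hold at least \<open>4 * p * m * card J'\<close> ones, but at most
    \<open>p * m * card J' + D\<close>. Hence \<open>D\<close> is at least three quarters of their
    number of ones.\<close>
  have bad_cols: "(\<Sum>a<m. \<Sum>b\<in>J'. A a b) \<le> 4 / 3 * D"
  proof -
    have "real (card J') * (4 * p * real m) = (\<Sum>b\<in>J'. 4 * p * real m)" by simp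
    also have "\<dots> \<le> (\<Sum>b\<in>J'. deg b)" by (rule sum_mono) (auto simp: J'_def J_def)
    also have "\<dots> = (\<Sum>a<m. \<Sum>b\<in>J'. A a b)" unfolding deg_def by (rule sum.swap)
    finally show ?thesis using ones[OF _ sub(4), of "{..<m}"] by (simp add: mult_ac)
  qed
  \<comment> \<open>The deleted fraction is at most 1/16 + (1 + 4/3)/16 < 1/2.\<close>
  have good: "p * real m * real n / 2 \<le> (\<Sum>a\<in>I. \<Sum>b\<in>J. A a b)"
  proof -
    have I_un: "(\<Sum>a<m. f a) = (\<Sum>a\<in>I. f a) + (\<Sum>a\<in>I'. f a)" for f :: "nat \<Rightarrow> real"
      unfolding I'_def using sub by (simp add: sum.subset_diff)
    have J_un: "(\<Sum>b<n. f b) = (\<Sum>b\<in>J. f b) + (\<Sum>b\<in>J'. f b)" for f :: "nat \<Rightarrow> real"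
      unfolding J'_def using sub by (simp add: sum.subset_diff)
    have "p * real m * real n = (\<Sum>a\<in>I. \<Sum>b<n. A a b) + (\<Sum>a\<in>I'. \<Sum>b<n. A a b)"
      unfolding p(1)[symmetric] by (rule I_un)
    also have "(\<Sum>a\<in>I. \<Sum>b<n. A a b) = (\<Sum>a\<in>I. \<Sum>b\<in>J. A a b) + (\<Sum>a\<in>I. \<Sum>b\<in>J'. A a b)"
      unfolding J_un by (rule sum.distrib)
    finally have "p * real m * real n = (\<Sum>a\<in>I. \<Sum>b\<in>J. A a b) + (\<Sum>a\<in>I. \<Sum>b\<in>J'. A a b)
        + (\<Sum>a\<in>I'. \<Sum>b<n. A a b)" .
    moreover have "(\<Sum>a\<in>I. \<Sum>b\<in>J'. A a b) \<le> (\<Sum>a<m. \<Sum>b\<in>J'. A a b)"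
      using sub A0 by (intro sum_mono2 sum_nonneg) auto
    moreover have "0 \<le> p * real m * real n" using p by simp
    ultimately show ?thesis using bad_rows bad_cols False by linarith
  qed
  \<comment> \<open>These bound the norms of the vectors kept: for columns, 4 from the degree and 1
    from the extra coordinate give 5.\<close>
  define \<alpha> where "\<alpha> = sqrt (16 * real (Suc k) / real m)"
  define \<beta> where "\<beta> = sqrt (5 * p * real m)"
  have \<alpha>: "\<alpha> > 0" "\<alpha> * \<alpha> = 16 * real (Suc k) / real m" using mn by (auto simp: \<alpha>_def)
  have \<beta>: "\<beta> > 0" "\<beta> * \<beta> = 5 * p * real m" using mn p by (auto simp: \<beta>_def)
  \<comment> \<open>Zero vectors outside \<open>I\<close> and \<open>J\<close> satisfy the norm
    bound and restrict the double sum to the good part.\<close>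
  define u where "u a i = (if a \<in> I then 1 / \<alpha> else 0) * x' a i" for a i
  define v where "v b i = (if b \<in> J then 1 / \<beta> else 0) * y' b i" for b i
  have groth: "(\<Sum>a<m. \<Sum>b<n. (A a b - p) * ip (Suc k) (u a) (v b)) \<le> 128 * (4 * D)"
  proof (rule grothendieck_inequality)
    show "(\<Sum>a<m. \<Sum>b<n. (A a b - p) * (f a * g b)) \<le> 4 * D"
      if "\<And>a. \<bar>f a\<bar> \<le> 1" "\<And>b. \<bar>g b\<bar> \<le> 1" for f g
      by (rule sum_prod_cube_le) (use D that in auto)
    fix a
    have "ip (Suc k) (x' a) (x' a) / (\<alpha> * \<alpha>) \<le> 1" if "a \<in> I"
    proof -
      have "ip (Suc k) (x' a) (x' a) \<le> \<alpha> * \<alpha>" using that unfolding \<alpha>(2) by (simp add: I_def)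
      then show ?thesis using \<alpha>(1) by simp
    qed
    then show "ip (Suc k) (u a) (u a) \<le> 1"
      unfolding u_def ip_scale_left ip_scale_right by simp
  next
    fix b
    have "ip (Suc k) (y' b) (y' b) / (\<beta> * \<beta>) \<le> 1" if "b \<in> J"
    proof -
      have "p\<^sup>2 * real m \<le> p * real m"
        using p mn by (intro mult_right_mono) (auto simp: power2_eq_square)
      then have "ip (Suc k) (y' b) (y' b) \<le> \<beta> * \<beta>"
        using that y'[of b] unfolding \<beta>(2) by (simp add: J_def)
      then show ?thesis using \<beta>(1) by simp
    qed
    then show "ip (Suc k) (v b) (v b) \<le> 1"
      unfolding v_def ip_scale_left ip_scale_right by simp
  qed
  have eq: "(\<Sum>a<m. \<Sum>b<n. (A a b - p) * ip (Suc k) (u a) (v b)) = (\<Sum>a\<in>I. \<Sum>b\<in>J. (A a b - p)\<^sup>2) / (\<alpha> * \<beta>)"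
  proof -
    have "(\<Sum>a<m. \<Sum>b<n. (A a b - p) * ip (Suc k) (u a) (v b))
        = (\<Sum>a<m. \<Sum>b<n. if a \<in> I then (if b \<in> J then (A a b - p)\<^sup>2 / (\<alpha> * \<beta>) else 0) else 0)"
      unfolding u_def v_def ip_scale_left ip_scale_right
      by (intro sum.cong refl) (auto simp: xy' power2_eq_square)
    also have "\<dots> = (\<Sum>a<m. if a \<in> I then (\<Sum>b<n. if b \<in> J then (A a b - p)\<^sup>2 / (\<alpha> * \<beta>) else 0) else 0)"
      by (intro sum.cong) auto
    also have "\<dots> = (\<Sum>a\<in>I. \<Sum>b\<in>J. (A a b - p)\<^sup>2 / (\<alpha> * \<beta>))"
      using sub by (simp add: sum.inter_restrict[symmetric] Int_absorb1)
    finally show ?thesis by (simp add: sum_divide_distrib)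
  qed
  \<comment> \<open>Since \<open>p\<close> is at most 1/2, each one contributes at least 1/4 to the
    sum of squares.\<close>
  have "p * real m * real n / 8 \<le> (\<Sum>a\<in>I. \<Sum>b\<in>J. A a b / 4)"
    using good by (simp flip: sum_divide_distrib)
  also have "\<dots> \<le> (\<Sum>a\<in>I. \<Sum>b\<in>J. (A a b - p)\<^sup>2)"
  proof (intro sum_mono)
    fix a b assume "a \<in> I" "b \<in> J"
    then have "A a b = 0 \<or> A a b = 1" using A sub by auto
    moreover have "(1/2)\<^sup>2 \<le> (1 - p)\<^sup>2" using p by (intro power_mono) auto
    ultimately show "A a b / 4 \<le> (A a b - p)\<^sup>2" by (auto simp: power2_eq_square)
  qed
  finally have sq: "p * real m * real n / 8 / (\<alpha> * \<beta>) \<le> 512 * D"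
    using groth \<alpha> \<beta> divide_right_mono[of "p * real m * real n / 8" _ "\<alpha> * \<beta>"] unfolding eq by fastforce
  \<comment> \<open>Here 80 = 16 * 5, the bound \<open>k + 1 \<le> 2 * r\<close> doubles it, and 160
    is rounded up to 13^2.\<close>
  have \<alpha>\<beta>: "\<alpha> * \<beta> \<le> 13 * (sqrt p * sqrt (real r))"
  proof -
    have "\<alpha> * \<beta> = sqrt (80 * p * real (Suc k))"
      using mn by (simp add: \<alpha>_def \<beta>_def flip: real_sqrt_mult)
    also have "\<dots> \<le> sqrt (169 * (p * real r))"
    proof (rule real_sqrt_le_mono)
      have "p * real (Suc k) \<le> p * (2 * real r)" using r p by (intro mult_left_mono) auto
      moreover have "0 \<le> p * real r" using p by simp
      ultimately show "80 * p * real (Suc k) \<le> 169 * (p * real r)" by simp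
    qed
    also have "\<dots> = 13 * (sqrt p * sqrt (real r))" by (simp add: real_sqrt_mult)
    finally show ?thesis .
  qed
  have "1 / 53248 * real m * real n * min p (sqrt p / sqrt (real r))
      \<le> 1 / 53248 * real m * real n * (sqrt p / sqrt (real r))"
    by (intro mult_left_mono) auto
  \<comment> \<open>The final constant is 53248 = 8 * 13 * 512, where 512 = 128 * 4 combines
    Grothendieck's inequality with the passage from signs to rectangles.\<close>
  also have "\<dots> = sqrt p * sqrt p * real m * real n / 8 / (13 * (sqrt p * sqrt (real r))) / 512"
  proof -
    have "1 / 53248 * M * N * (s / t) = s * s * M * N / 8 / (13 * (s * t)) / 512"
      if "s > 0" "t > 0" for M N s t :: real
      using that by (simp add: field_simps)
    then show ?thesis by this (use p r in auto)
  qed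
  also have "\<dots> = p * real m * real n / 8 / (13 * (sqrt p * sqrt (real r))) / 512"
    by (simp only: real_sqrt_mult_self abs_of_pos[OF p(2)])
  also have "\<dots> \<le> p * real m * real n / 8 / (\<alpha> * \<beta>) / 512"
    using \<alpha>(1) \<beta>(1) \<alpha>\<beta> p(2) r(1) by (intro divide_right_mono divide_left_mono mult_pos_pos) auto
  finally show ?thesis using sq by simp
qed

section \<open>Transfer to matrices and \<open>disc\<close>\<close>

lemma real_sub_ones:
  assumes "finite X" "finite Y" "\<And>a b. a \<in> X \<Longrightarrow> b \<in> Y \<Longrightarrow> M $$ (a, b) = 0 \<or> M $$ (a, b) = 1"
  shows "real (sub_ones M X Y) = (\<Sum>a\<in>X. \<Sum>b\<in>Y. M $$ (a, b))"
proof -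
  have "{(i, j). i \<in> X \<and> j \<in> Y \<and> M $$ (i, j) = 1} = {z \<in> X \<times> Y. M $$ z = 1}" by auto
  then have "real (sub_ones M X Y) = (\<Sum>z\<in>{z \<in> X \<times> Y. M $$ z = 1}. 1)"
    by (simp add: sub_ones_def)
  also have "\<dots> = (\<Sum>z\<in>X \<times> Y. if M $$ z = 1 then 1 else 0)"
    using assms(1,2) by (simp only: sum.inter_filter finite_cartesian_product)
  also have "\<dots> = (\<Sum>z\<in>X \<times> Y. M $$ z)"
    using assms(3) by (intro sum.cong) fastforce+
  finally show ?thesis by (simp add: sum.cartesian_product)
qed

lemma disc_upper:
  assumes "X \<subseteq> {..<dim_row M}" "Y \<subseteq> {..<dim_col M}"
  shows "\<bar>real (sub_ones M X Y) - density M * real (card X) * real (card Y)\<bar> \<le> disc M"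
  unfolding disc_def by (rule Max_ge) (use assms in auto)

theorem theorem1p2:
  shows "\<exists>c::real. c > 0 \<and>
    (\<forall>(r::nat) (m::nat) (n::nat) (M::real mat).
       r > 0 \<longrightarrow> m > 0 \<longrightarrow> n > 0 \<longrightarrow> M \<in> carrier_mat m n \<longrightarrow>
       (\<forall>i<m. \<forall>j<n. M $$ (i, j) = 0 \<or> M $$ (i, j) = 1) \<longrightarrow>
       vec_space.rank m M \<le> r \<longrightarrow>
       density M \<le> 1/2 \<longrightarrow>
       disc M \<ge> c * real m * real n * min (density M) (sqrt (density M) / sqrt (real r)))"
proof (rule exI[of _ "1 / 53248"], intro conjI allI impI)
  fix r m n :: nat and M :: "real mat"
  assume r: "r > 0" and m: "m > 0" and n: "n > 0" and M: "M \<in> carrier_mat m n"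
    and M01: "\<forall>i<m. \<forall>j<n. M $$ (i, j) = 0 \<or> M $$ (i, j) = 1"
    and rank: "vec_space.rank m M \<le> r" and p: "density M \<le> 1/2"
  have dim: "dim_row M = m" "dim_col M = n" using M by auto
  have D: "\<bar>\<Sum>a\<in>X. \<Sum>b\<in>Y. M $$ (a, b) - density M\<bar> \<le> disc M"
    if "X \<subseteq> {..<m}" "Y \<subseteq> {..<n}" for X Y
  proof -
    have "real (sub_ones M X Y) = (\<Sum>a\<in>X. \<Sum>b\<in>Y. M $$ (a, b))"
      by (rule real_sub_ones) (use that M01 in \<open>auto intro: finite_subset\<close>)
    then show ?thesis
      using disc_upper[of X M Y] that dim by (simp add: sum_subtractf mult_ac)
  qed
  show "1 / 53248 * real m * real n * min (density M) (sqrt (density M) / sqrt (real r)) \<le> disc M"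
  proof (cases "density M = 0")
    case True
    \<comment> \<open>The claimed bound is 0 here, and the empty rectangle shows that
      \<open>disc M\<close> is nonnegative.\<close>
    then show ?thesis using D[of "{}" "{}"] by simp
  next
    case False
    moreover have "0 \<le> density M" by (simp add: density_def)
    ultimately have p0: "0 < density M" by linarith
    have total: "(\<Sum>a<m. \<Sum>b<n. M $$ (a, b)) = density M * real m * real n"
      using m n M01 real_sub_ones[of "{..<m}" "{..<n}" M] by (simp add: density_def ones_def dim)
    obtain k x y where k: "k \<le> vec_space.rank m M"
      and xy: "\<forall>a<m. \<forall>b<n. M $$ (a, b) = ip k (x a) (y b)"
      and x: "(\<Sum>a<m. ip k (x a) (x a)) = real k"
      and y: "\<forall>b<n. ip k (y b) (y b) = (\<Sum>a<m. (M $$ (a, b))\<^sup>2)"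
      using rank_factorization[OF M] by blast
    show ?thesis
    proof (rule discrepancy_lower_bound[OF m n r order_trans[OF k rank] _ total p0 p D _ x])
      show "M $$ (a, b) = 0 \<or> M $$ (a, b) = 1" if "a < m" "b < n" for a b
        using M01 that by blast
    qed (use xy y in auto)
  qed
qed simp

end
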